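(* Let $n$ be a natural number and regard $\mathbb{Z}^n\subset\mathbb{R}^n$. (1) Every total order compatible with addition on the group $\mathbb{Z}^n$, or on any subsemigroup $S\subset\mathbb{Z}^n$, is induced by the lexicographic order $\succ_{\mathbf{x}}$ on $\mathbb{R}^n$ related to some coordinate system $\mathbf{x}=(x_1,\dots,x_n)$ on $\mathbb{R}^n$. (2) Such an order $\succ_{\mathbf{x}}$ on a finitely generated subsemigroup $S\subset\mathbb{Z}^n$ is a well-order on $S$ if and only if every nonzero element $a\in S$ satisfies $2a\succ_{\mathbf{x}} a$. (3) In particular, the semigroup $\mathbb{Z}^n_{\geq 0}$ of integral points with nonnegative coordinates is a well-ordered set with respect to the lexicographic order $\succ_{\mathbf{x}}$ if and only if the origin is the smallest element of $\mathbb{Z}^n_{\geq 0}$ with respect to $\succ_{\mathbf{x}}$.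
   Context: A total order is understood as a strict total order. A total order $\succ$ on a commutative semigroup (or group) $S$ is compatible with addition if for all $x,y,a\in S$ with $x\succ y$ one has $x+a\succ y+a$. A subsemigroup is a subset closed under addition (it need not contain $0$); it is finitely generated if it consists of all finite nonempty sums of elements of some finite subset. A coordinate system $\mathbf{x}=(x_1,\dots,x_n)$ on an $n$-dimensional real vector space $L$ is the ordered tuple of coordinate functions associated with an ordered basis of $L$ (an arbitrary real basis). The lexicographic order $\succ_{\mathbf{x}}$ related to $\mathbf{x}$ is: for distinct $a,b\in L$, $a\succ_{\mathbf{x}} b$ if and only if $x_i(a)>x_i(b)$, where $i$ is the smallest index with $x_i(a)\neq x_i(b)$. An order on a subset of $L$ is induced by $\succ_{\mathbf{x}}$ if it is the restriction of $\succ_{\mathbf{x}}$. An ordered set is well-ordered if every nonempty subset has a smallest element, where $x$ is smaller than $y$ when $y\succ x$. *)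

theory Defs
  imports "HOL-Analysis.Analysis"
begin

text \<open>
  Orders are strict and written as binary predicates: \<open>gr x y\<close> reads \<open>x \<succ> y\<close>.
  The predicates ending in \<open>_on\<close> concern only the restriction of \<open>gr\<close> to \<open>S\<close>.
\<close>

definition strict_total_order_on :: "'a set \<Rightarrow> ('a \<Rightarrow> 'a \<Rightarrow> bool) \<Rightarrow> bool" where
  "strict_total_order_on S gr \<longleftrightarrow> irreflp_on S gr \<and> transp_on S gr \<and> totalp_on S gr"

definition compatible_with_add_on ::
    "'a::ab_semigroup_add set \<Rightarrow> ('a \<Rightarrow> 'a \<Rightarrow> bool) \<Rightarrow> bool" where
  "compatible_with_add_on S gr \<longleftrightarrow> (\<forall>x\<in>S. \<forall>y\<in>S. \<forall>a\<in>S. gr x y \<longrightarrow> gr (x + a) (y + a))"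

definition well_ordered_on :: "'a set \<Rightarrow> ('a \<Rightarrow> 'a \<Rightarrow> bool) \<Rightarrow> bool" where
  "well_ordered_on S gr \<longleftrightarrow> strict_total_order_on S gr \<and>
     (\<forall>T. T \<subseteq> S \<and> T \<noteq> {} \<longrightarrow> (\<exists>m\<in>T. \<forall>t\<in>T. t \<noteq> m \<longrightarrow> gr t m))"

definition subsemigroup :: "'a::ab_semigroup_add set \<Rightarrow> bool" where
  "subsemigroup S \<longleftrightarrow> (\<forall>x\<in>S. \<forall>y\<in>S. x + y \<in> S)"

definition finitely_generated_semigroup :: "'a::comm_monoid_add set \<Rightarrow> bool" where
  "finitely_generated_semigroup S \<longleftrightarrow>
     (\<exists>F. finite F \<and> S = {sum_list xs | xs. xs \<noteq> [] \<and> set xs \<subseteq> F})"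

text \<open>
  A coordinate system is given by its ordered basis, a list of vectors; its \<open>i\<close>-th coordinate
  function, counted from \<open>0\<close>, is \<open>coord bs i\<close>.
\<close>

definition ordered_basis :: "'a::real_vector list \<Rightarrow> bool" where
  "ordered_basis bs \<longleftrightarrow> distinct bs \<and> independent (set bs) \<and> span (set bs) = UNIV"

definition coord :: "'a::real_vector list \<Rightarrow> nat \<Rightarrow> 'a \<Rightarrow> real" where
  "coord bs i v = representation (set bs) v (bs ! i)"

definition lex_greater :: "'a::real_vector list \<Rightarrow> 'a \<Rightarrow> 'a \<Rightarrow> bool" where
  "lex_greater bs a b \<longleftrightarrow> a \<noteq> b \<and>
     (let i = (LEAST i. i < length bs \<and> coord bs i a \<noteq> coord bs i b)
      in coord bs i a > coord bs i b)"

definition induced_on :: "'a set \<Rightarrow> ('a \<Rightarrow> 'a \<Rightarrow> bool) \<Rightarrow> ('a \<Rightarrow> 'a \<Rightarrow> bool) \<Rightarrow> bool" where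
  "induced_on S gr gr' \<longleftrightarrow> (\<forall>a\<in>S. \<forall>b\<in>S. gr a b \<longleftrightarrow> gr' a b)"

definition integer_points :: "(real ^ 'n) set" where
  "integer_points = {v. \<forall>i. v $ i \<in> \<int>}"

definition nonneg_integer_points :: "(real ^ 'n) set" where
  "nonneg_integer_points = {v \<in> integer_points. \<forall>i. v $ i \<ge> 0}"

end

theory Submission
  imports Defs
begin

text \<open>
  The differences \<open>a - b\<close> with \<open>a \<succ> b\<close> form a set \<open>P \<subseteq> \<int>\<^sup>n\<close> that is closed under addition and
  misses \<open>0\<close>. Then \<open>0\<close> is not even in the convex hull of \<open>P\<close>: given a real relation
  \<open>\<Sum> u\<^sub>p p = 0\<close> with positive \<open>u\<^sub>p\<close>, Dirichlet's theorem yields \<open>q \<ge> 1\<close> such that all \<open>q u\<^sub>p\<close> are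
  close to positive integers \<open>m\<^sub>p\<close>; the integer vector \<open>\<Sum> m\<^sub>p p\<close> has norm below \<open>1\<close>, hence
  vanishes, and so \<open>0 \<in> P\<close>. Separating \<open>0\<close> from the convex hull by a hyperplane, and repeating
  this inside that hyperplane, gives an orthogonal basis for which all of \<open>P\<close> is
  lexicographically positive.

  For the well-order criterion, a strictly descending sequence of nonnegative integer combinations
  of finitely many lexicographically nonnegative generators has, by Dickson's lemma, two members
  with componentwise increasing coefficients, which is a contradiction.
\<close>

section \<open>Lexicographically positive vectors\<close>

text \<open>The positive cone of \<open>lex_greater bs\<close>. As that order is translation
  invariant, comparing \<open>a\<close> with \<open>b\<close> becomes a condition on the single
  vector \<open>a - b\<close>; the explicit index avoids \<open>LEAST\<close>.\<close>

definition lex_pos :: "'a::real_vector list \<Rightarrow> 'a \<Rightarrow> bool" where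
  "lex_pos bs v \<longleftrightarrow> (\<exists>i<length bs. coord bs i v > 0 \<and> (\<forall>j<i. coord bs j v = 0))"

lemma coord_add: "ordered_basis bs \<Longrightarrow> coord bs i (v + w) = coord bs i v + coord bs i w"
  by (simp add: coord_def ordered_basis_def real_vector.representation_add)

lemma coord_diff: "ordered_basis bs \<Longrightarrow> coord bs i (v - w) = coord bs i v - coord bs i w"
  by (simp add: coord_def ordered_basis_def real_vector.representation_diff)

lemma coord_minus: "ordered_basis bs \<Longrightarrow> coord bs i (- v) = - coord bs i v"
  by (simp add: coord_def ordered_basis_def real_vector.representation_neg)

lemma coord_scaleR: "ordered_basis bs \<Longrightarrow> coord bs i (c *\<^sub>R v) = c * coord bs i v"
  by (simp add: coord_def ordered_basis_def real_vector.representation_scale)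

lemma coord_zero: "coord bs i 0 = 0"
  by (simp add: coord_def real_vector.representation_zero)

lemma coord_nonzero_ex:
  assumes "ordered_basis bs" "v \<noteq> 0"
  obtains i where "i < length bs" "coord bs i v \<noteq> 0"
proof -
  have "(\<Sum>b\<in>set bs. representation (set bs) v b *\<^sub>R b) = v"
    using assms by (intro real_vector.sum_representation_eq) (auto simp: ordered_basis_def)
  with assms(2) obtain b where "b \<in> set bs" "representation (set bs) v b \<noteq> 0"
    by (metis (mono_tags, lifting) scaleR_zero_left sum.neutral)
  with that show thesis
    by (auto simp: in_set_conv_nth coord_def)
qed

lemma lex_pos_zero: "\<not> lex_pos bs 0"
  by (simp add: lex_pos_def coord_zero)

text \<open>The leading index of the sum is the smaller of the two leading indices. If they
  coincide, two positive entries are added, so nothing cancels.\<close>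

lemma lex_pos_add:
  assumes "ordered_basis bs" "lex_pos bs v" "lex_pos bs w"
  shows "lex_pos bs (v + w)"
proof -
  obtain i j where i: "i < length bs" "coord bs i v > 0" "\<forall>k<i. coord bs k v = 0"
    and j: "j < length bs" "coord bs j w > 0" "\<forall>k<j. coord bs k w = 0"
    using assms by (auto simp: lex_pos_def)
  have "coord bs (min i j) (v + w) > 0"
    using i j by (cases i j rule: linorder_cases) (auto simp: coord_add[OF assms(1)])
  moreover have "\<forall>k<min i j. coord bs k (v + w) = 0"
    using i j by (simp add: coord_add[OF assms(1)])
  ultimately show ?thesis
    using i(1) unfolding lex_pos_def by (intro exI[of _ "min i j"]) auto
qed

lemma lex_pos_scaleR:
  assumes "ordered_basis bs" "lex_pos bs v" "c > 0"
  shows "lex_pos bs (c *\<^sub>R v)"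
  using assms unfolding lex_pos_def coord_scaleR[OF assms(1)]
  by (auto simp: zero_less_mult_iff)

lemma lex_pos_total:
  assumes "ordered_basis bs" "v \<noteq> 0"
  shows "lex_pos bs v \<or> lex_pos bs (- v)"
proof -
  let ?Q = "\<lambda>i. i < length bs \<and> coord bs i v \<noteq> 0"
  define i where "i = (LEAST i. ?Q i)"
  have i: "?Q i"
    unfolding i_def by (rule LeastI_ex) (metis coord_nonzero_ex assms)
  have "\<forall>j<i. coord bs j v = 0"
    using i not_less_Least[of _ ?Q] unfolding i_def by (meson less_trans)
  with i show ?thesis
    unfolding lex_pos_def coord_minus[OF assms(1)] by (metis neg_0_less_iff_less neg_equal_0_iff_equal linorder_neqE)
qed

lemma lex_greater_iff_lex_pos:
  assumes "ordered_basis bs"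
  shows "lex_greater bs a b \<longleftrightarrow> lex_pos bs (a - b)"
proof
  assume "lex_greater bs a b"
  let ?Q = "\<lambda>i. i < length bs \<and> coord bs i a \<noteq> coord bs i b"
  define i where "i = (LEAST i. ?Q i)"
  have ab: "a - b \<noteq> 0" and gt: "coord bs i a > coord bs i b"
    using \<open>lex_greater bs a b\<close> by (auto simp: lex_greater_def Let_def i_def)
  have "\<exists>i. ?Q i"
    using coord_nonzero_ex[OF assms ab] by (auto simp: coord_diff[OF assms])
  hence i: "?Q i"
    unfolding i_def by (rule LeastI_ex)
  have "\<forall>j<i. coord bs j a = coord bs j b"
    using i not_less_Least[of _ ?Q] unfolding i_def by (meson less_trans)
  with i gt show "lex_pos bs (a - b)"
    by (auto simp: lex_pos_def coord_diff[OF assms])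
next
  assume "lex_pos bs (a - b)"
  then obtain i where i: "i < length bs" "coord bs i a > coord bs i b"
      "\<forall>j<i. coord bs j a = coord bs j b"
    by (auto simp: lex_pos_def coord_diff[OF assms])
  have "(LEAST i. i < length bs \<and> coord bs i a \<noteq> coord bs i b) = i"
    using i by (intro Least_equality) (auto simp: not_less[symmetric])
  with i show "lex_greater bs a b"
    by (auto simp: lex_greater_def Let_def)
qed

lemma strict_total_order_on_lex_greater:
  assumes "ordered_basis bs"
  shows "strict_total_order_on S (lex_greater bs)"
  unfolding strict_total_order_on_def
proof (intro conjI irreflp_onI transp_onI totalp_onI)
  show "\<not> lex_greater bs x x" for x
    by (simp add: lex_greater_def)
  show "lex_greater bs x z" if "lex_greater bs x y" "lex_greater bs y z" for x y z
    using lex_pos_add[OF assms, of "x - y" "y - z"] that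
    by (simp add: lex_greater_iff_lex_pos[OF assms])
  show "lex_greater bs x y \<or> lex_greater bs y x" if "x \<noteq> y" for x y
    using lex_pos_total[OF assms, of "x - y"] that
    by (simp add: lex_greater_iff_lex_pos[OF assms])
qed

subsection \<open>Orders on semigroups of integral points\<close>

lemma sum_pos_multiples_mem:
  fixes P :: "'a::real_vector set"
  assumes add: "\<And>x y. x \<in> P \<Longrightarrow> y \<in> P \<Longrightarrow> x + y \<in> P"
    and F: "finite F" "F \<noteq> {}" "F \<subseteq> P" and m: "\<And>x. x \<in> F \<Longrightarrow> m x > (0::nat)"
  shows "(\<Sum>x\<in>F. real (m x) *\<^sub>R x) \<in> P"
proof -
  \<comment> \<open>\<open>Suc k\<close> skips the zeroth multiple, since \<open>P\<close> need not
    contain \<open>0\<close>.\<close>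
  have mult: "real (Suc k) *\<^sub>R x \<in> P" if "x \<in> P" for x k
  proof (induction k)
    case (Suc k)
    have "real (Suc (Suc k)) *\<^sub>R x = x + real (Suc k) *\<^sub>R x"
      by (metis of_nat_Suc scaleR_left_distrib scaleR_one)
    with add[OF that Suc] show ?case by (simp only:)
  qed (use that in simp)
  have "real (m x) *\<^sub>R x \<in> P" if "x \<in> F" for x
    using mult[of x "m x - 1"] m[OF that] F(3) that by auto
  with F(1,2) show ?thesis
    by (induction F rule: finite_ne_induct) (auto intro: add)
qed

lemma integer_point_eq_0:
  fixes v :: "real ^ 'n"
  assumes "v \<in> integer_points" "norm v < 1"
  shows "v = 0"
proof -
  have "v $ i = 0" for i
  proof -
    have "\<bar>v $ i\<bar> < 1" using component_le_norm_cart[of v i] assms(2) by linarith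
    moreover have "v $ i \<in> \<int>" using assms(1) by (simp add: integer_points_def)
    ultimately show ?thesis by (metis Ints_nonzero_abs_less1)
  qed
  thus ?thesis by (simp add: vec_eq_iff)
qed

text \<open>Closure under addition by itself excludes only relations with positive integer
  coefficients; real relations are reduced to these by discreteness of the lattice.\<close>

lemma zero_notin_convex_hull:
  fixes P :: "(real ^ 'n) set"
  assumes P: "P \<subseteq> integer_points" and add: "\<And>x y. x \<in> P \<Longrightarrow> y \<in> P \<Longrightarrow> x + y \<in> P"
    and zero: "0 \<notin> P"
  shows "0 \<notin> convex hull P"
proof
  assume "0 \<in> convex hull P"
  then obtain S u where S: "finite S" "S \<subseteq> P" "\<forall>x\<in>S. 0 \<le> u x" "sum u S = (1::real)"
      "(\<Sum>v\<in>S. u v *\<^sub>R v) = 0"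
    unfolding convex_hull_explicit by auto
  define F where "F = {x\<in>S. u x > 0}"
  have F: "finite F" "F \<subseteq> P" using S by (auto simp: F_def)
  have Fsum: "(\<Sum>v\<in>F. u v *\<^sub>R v) = 0"
    using S(1,3) unfolding S(5)[symmetric] F_def
    by (intro sum.mono_neutral_left) (auto simp: less_le)
  have "F \<noteq> {}"
  proof
    assume "F = {}"
    hence "sum u S = 0" using S(3) by (intro sum.neutral) (force simp: F_def)
    with S(4) show False by simp
  qed
  define \<mu> where "\<mu> = Min (u ` F)"
  have \<mu>: "\<mu> > 0" "\<And>x. x \<in> F \<Longrightarrow> \<mu> \<le> u x"
    using F(1) \<open>F \<noteq> {}\<close> by (auto simp: \<mu>_def F_def)
  define K where "K = (\<Sum>v\<in>F. norm v)"
  \<comment> \<open>\<open>N\<close> has two tasks: \<open>1 / N < \<mu>\<close> keeps the rounded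
    coefficients positive, and \<open>K < N\<close> pushes the norm of the rounded combination below
    \<open>1\<close>.\<close>
  obtain N :: nat where N: "real N > max (1 / \<mu>) K"
    using reals_Archimedean2 by blast
  have "N > 0" using N \<mu>(1) by (cases N) (auto simp: divide_less_0_iff)
  have N1: "1 / N < \<mu>" using N \<mu>(1) \<open>N > 0\<close> by (simp add: field_simps)
  obtain e where e: "bij_betw e {0..<card F} F"
    using ex_bij_betw_nat_finite[OF F(1)] by blast
  obtain q p where q: "0 < q"
    and qp: "\<And>i. i < card F \<Longrightarrow> \<bar>of_int q * u (e i) - of_int (p i)\<bar> < 1/N"
    using Dirichlet_approx_simult[OF \<open>N > 0\<close>, where \<theta> = "\<lambda>i. u (e i)" and n = "card F"] by blast
  \<comment> \<open>Dirichlet's theorem speaks of indexed families; \<open>m\<close> carries the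
    numerators \<open>p\<close> back to \<open>F\<close> along the enumeration
    \<open>e\<close>.\<close>
  define m where "m x = p (inv_into {0..<card F} e x)" for x
  have m: "\<bar>of_int q * u x - of_int (m x)\<bar> < 1/N" if "x \<in> F" for x
    using qp[of "inv_into {0..<card F} e x"] e that
    by (metis atLeastLessThan_iff bij_betw_def bij_betw_inv_into_right inv_into_into m_def)
  have mpos: "m x > 0" if "x \<in> F" for x
  proof -
    have "1 * u x \<le> of_int q * u x"
      using q \<mu> that by (intro mult_right_mono) (auto intro: less_imp_le simp: F_def)
    with m[OF that] \<mu>(2)[OF that] N1 have "real_of_int (m x) > 0" by linarith
    thus ?thesis by simp
  qed
  define w where "w = (\<Sum>x\<in>F. real (nat (m x)) *\<^sub>R x)"
  have "w \<in> P"
    unfolding w_def using sum_pos_multiples_mem[of P F "\<lambda>x. nat (m x)"] add F \<open>F \<noteq> {}\<close> mpos by auto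
  have "norm w < 1"
  proof -
    \<comment> \<open>The subtracted term is \<open>q\<close> times the given relation, hence zero;
      it leaves only the rounding errors as coefficients.\<close>
    have "w = (\<Sum>x\<in>F. of_int (m x) *\<^sub>R x) - of_int q *\<^sub>R (\<Sum>x\<in>F. u x *\<^sub>R x)"
      unfolding w_def Fsum using mpos by (auto intro!: sum.cong simp: less_imp_le)
    also have "\<dots> = (\<Sum>x\<in>F. (of_int (m x) - of_int q * u x) *\<^sub>R x)"
      by (simp add: scaleR_right.sum sum_subtractf scaleR_left_diff_distrib)
    finally have "norm w \<le> (\<Sum>x\<in>F. norm ((of_int (m x) - of_int q * u x) *\<^sub>R x))"
      by (simp only: norm_sum)
    also have "\<dots> \<le> (\<Sum>x\<in>F. 1/N * norm x)"
    proof (rule sum_mono)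
      fix x assume "x \<in> F"
      from m[OF this] show "norm ((of_int (m x) - of_int q * u x) *\<^sub>R x) \<le> 1/N * norm x"
        unfolding norm_scaleR by (intro mult_right_mono) auto
    qed
    also have "\<dots> = K / N" by (simp add: K_def sum_divide_distrib)
    also have "\<dots> < 1" using N \<open>N > 0\<close> by simp
    finally show ?thesis .
  qed
  with \<open>w \<in> P\<close> P zero integer_point_eq_0[of w] show False by auto
qed

text \<open>Induction on the dimension: a supporting functional \<open>a\<close> is only weakly
  positive on \<open>C\<close>, and the points where it vanishes are treated inside the hyperplane
  orthogonal to \<open>a\<close>. Inner products replace coordinates, which is harmless for signs
  because the list is orthogonal.\<close>

lemma orthogonal_list_lex_pos:
  fixes V C :: "'a::euclidean_space set"
  assumes "subspace V" "convex C" "0 \<notin> C" "C \<subseteq> V"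
  shows "\<exists>bs. distinct bs \<and> pairwise orthogonal (set bs) \<and> 0 \<notin> set bs \<and> span (set bs) = V \<and>
           (\<forall>c\<in>C. \<exists>i<length bs. 0 < c \<bullet> bs ! i \<and> (\<forall>j<i. c \<bullet> bs ! j = 0))"
  using assms
proof (induction "dim V" arbitrary: V C rule: less_induct)
  case (less V C)
  show ?case
  proof (cases "V = {0}")
    case True
    with less.prems have "C = {}" by auto
    with True show ?thesis by (intro exI[of _ "[]"]) auto
  next
    case False
    \<comment> \<open>The normal vector must lie in \<open>V\<close>, so separation is carried out
      in the span of \<open>C\<close>. For empty \<open>C\<close> any nonzero vector of
      \<open>V\<close> will do.\<close>
    obtain a where a: "a \<in> V" "a \<noteq> 0" "\<And>x. x \<in> C \<Longrightarrow> 0 \<le> a \<bullet> x"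
    proof (cases "C = {}")
      case True
      with False that less.prems(1) show ?thesis by (auto dest: subspace_0)
    next
      case False
      with separating_hyperplane_set_0_inspan[of C] that less.prems show ?thesis
        by (metis span_minimal subsetD)
    qed
    define H where "H = {x. a \<bullet> x = 0}"
    have H: "subspace H" unfolding H_def by (rule subspace_hyperplane)
    have "a \<notin> H" using a(2) by (simp add: H_def)
    have sub: "subspace (V \<inter> H)" using less.prems(1) H by (rule subspace_inter)
    have "dim (V \<inter> H) < dim V"
      using less.prems(1) sub a(1) \<open>a \<notin> H\<close>
      by (intro dim_psubset) (auto simp: span_eq_iff[THEN iffD2])
    from less.hyps[OF this sub, of "C \<inter> H"] less.prems
    obtain bs where bs: "distinct bs" "pairwise orthogonal (set bs)" "0 \<notin> set bs"
        "span (set bs) = V \<inter> H"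
        "\<And>c. c \<in> C \<inter> H \<Longrightarrow> \<exists>i<length bs. 0 < c \<bullet> bs ! i \<and> (\<forall>j<i. c \<bullet> bs ! j = 0)"
      using convex_Int[OF less.prems(2) subspace_imp_convex[OF H]] by blast
    have bsH: "set bs \<subseteq> V \<inter> H" using bs(4) span_superset[of "set bs"] by simp
    have "span (set (a # bs)) = V"
    proof
      show "span (set (a # bs)) \<subseteq> V"
        using a(1) bsH less.prems(1) by (intro span_minimal) auto
      show "V \<subseteq> span (set (a # bs))"
      proof
        fix x assume "x \<in> V"
        \<comment> \<open>\<open>k *\<^sub>R a\<close> is the orthogonal projection of
          \<open>x\<close> to the line through \<open>a\<close>.\<close>
        define k where "k = (a \<bullet> x) / (a \<bullet> a)"
        have "x - k *\<^sub>R a \<in> V \<inter> H"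
          using \<open>x \<in> V\<close> a(1,2) less.prems(1)
          by (auto simp: H_def k_def inner_diff_right subspace_diff subspace_scale)
        hence "x - k *\<^sub>R a \<in> span (set bs)" by (simp add: bs(4))
        thus "x \<in> span (set (a # bs))" by (auto simp: span_insert)
      qed
    qed
    moreover have "\<exists>i<length (a # bs). 0 < c \<bullet> (a # bs) ! i \<and> (\<forall>j<i. c \<bullet> (a # bs) ! j = 0)"
      if "c \<in> C" for c
    proof (cases "a \<bullet> c = 0")
      case True
      with bs(5)[of c] that obtain i where i: "i < length bs" "0 < c \<bullet> bs ! i"
          "\<forall>j<i. c \<bullet> bs ! j = 0" by (auto simp: H_def)
      \<comment> \<open>Putting \<open>a\<close> in front shifts the leading index by one.\<close>
      with True show ?thesis
        by (intro exI[of _ "Suc i"]) (auto simp: less_Suc_eq_0_disj inner_commute)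
    next
      case False
      with a(3)[OF that] show ?thesis by (intro exI[of _ 0]) (simp add: inner_commute)
    qed
    moreover have "pairwise orthogonal (set (a # bs))"
      using bs(2) bsH by (auto simp: pairwise_insert orthogonal_def H_def inner_commute)
    moreover have "distinct (a # bs)" "0 \<notin> set (a # bs)"
      using bs(1,3) bsH \<open>a \<notin> H\<close> a(2) by auto
    ultimately show ?thesis by blast
  qed
qed

text \<open>All other basis vectors drop out by orthogonality. As the factor
  \<open>bs ! i \<bullet> bs ! i\<close> is positive for a basis vector, coordinates and inner
  products have the same sign.\<close>

lemma coord_orthogonal:
  fixes bs :: "'a::euclidean_space list"
  assumes "ordered_basis bs" "pairwise orthogonal (set bs)" "i < length bs"
  shows "v \<bullet> bs ! i = coord bs i v * (bs ! i \<bullet> bs ! i)"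
proof -
  let ?r = "representation (set bs) v"
  have "(\<Sum>b\<in>set bs. ?r b *\<^sub>R b) = v"
    using assms by (intro real_vector.sum_representation_eq) (auto simp: ordered_basis_def)
  hence "v \<bullet> bs ! i = (\<Sum>b\<in>set bs. ?r b * (b \<bullet> bs ! i))"
    by (metis (no_types, lifting) inner_scaleR_left inner_sum_left sum.cong)
  also have "\<dots> = (\<Sum>b\<in>{bs ! i}. ?r b * (b \<bullet> bs ! i))"
    using assms(2,3) by (intro sum.mono_neutral_right) (auto simp: pairwise_def orthogonal_def)
  finally show ?thesis by (simp add: coord_def)
qed

lemma ordered_basis_lex_pos_convex:
  fixes C :: "'a::euclidean_space set"
  assumes "convex C" "0 \<notin> C"
  obtains bs where "ordered_basis bs" "\<And>c. c \<in> C \<Longrightarrow> lex_pos bs c"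
proof -
  obtain bs where bs: "distinct bs" "pairwise orthogonal (set bs)" "0 \<notin> set bs"
      "span (set bs) = (UNIV :: 'a set)"
      "\<And>c. c \<in> C \<Longrightarrow> \<exists>i<length bs. 0 < c \<bullet> bs ! i \<and> (\<forall>j<i. c \<bullet> bs ! j = 0)"
    using orthogonal_list_lex_pos[OF subspace_UNIV assms] by auto
  have basis: "ordered_basis bs"
    using bs by (simp add: ordered_basis_def pairwise_orthogonal_independent)
  have pos: "bs ! i \<bullet> bs ! i > 0" if "i < length bs" for i
    using bs(3) that by (metis inner_gt_zero_iff nth_mem)
  have "lex_pos bs c" if c: "c \<in> C" for c
  proof -
    obtain i where i: "i < length bs" "0 < c \<bullet> bs ! i" "\<forall>j<i. c \<bullet> bs ! j = 0"
      using bs(5)[OF c] by blast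
    have "coord bs i c > 0"
      using i(1,2) pos[OF i(1)] coord_orthogonal[OF basis bs(2) i(1), of c]
      by (simp add: zero_less_mult_iff)
    moreover have "coord bs j c = 0" if "j < i" for j
      using i(1,3) that pos[of j] coord_orthogonal[OF basis bs(2), of j c] by simp
    ultimately show ?thesis using i(1) by (auto simp: lex_pos_def)
  qed
  with basis that show thesis by blast
qed

text \<open>Making all differences lexicographically positive gives one implication; the converse
  follows from totality of \<open>gr\<close> and asymmetry of the lexicographic order.\<close>

lemma compatible_order_induced_by_lex:
  fixes S :: "(real ^ 'n) set"
  assumes S: "S \<subseteq> integer_points" "subsemigroup S"
    and ord: "strict_total_order_on S gr" and comp: "compatible_with_add_on S gr"
  obtains bs where "ordered_basis bs" "induced_on S gr (lex_greater bs)"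
proof -
  have irrefl: "\<not> gr a a" if "a \<in> S" for a
    using ord that by (auto simp: strict_total_order_on_def irreflp_on_def)
  have trans: "gr a c" if "gr a b" "gr b c" "a \<in> S" "b \<in> S" "c \<in> S" for a b c
    using ord that by (meson strict_total_order_on_def transp_onD)
  have total: "a = b \<or> gr a b \<or> gr b a" if "a \<in> S" "b \<in> S" for a b
    using ord that by (auto simp: strict_total_order_on_def totalp_on_def)
  have comp: "gr (a + c) (b + c)" if "gr a b" "a \<in> S" "b \<in> S" "c \<in> S" for a b c
    using comp that by (auto simp: compatible_with_add_on_def)
  have closed: "a + b \<in> S" if "a \<in> S" "b \<in> S" for a b
    using S(2) that by (auto simp: subsemigroup_def)
  define P where "P = {a - b | a b. a \<in> S \<and> b \<in> S \<and> gr a b}"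
  have "P \<subseteq> integer_points"
    using S(1) by (auto simp: P_def integer_points_def subset_iff)
  moreover have "x + y \<in> P" if xy: "x \<in> P" "y \<in> P" for x y
  proof -
    obtain a b c d where *: "x = a - b" "a \<in> S" "b \<in> S" "gr a b"
        "y = c - d" "c \<in> S" "d \<in> S" "gr c d"
      using xy unfolding P_def by blast
    \<comment> \<open>Only elements of \<open>S\<close> may be used as translations, so the sum of
      two differences is handled through the intermediate point \<open>b + c\<close>.\<close>
    have "gr (a + c) (b + c)" "gr (b + c) (b + d)"
      using * comp[of a b c] comp[of c d b] by (auto simp: add.commute)
    hence "gr (a + c) (b + d)"
      using * closed by (intro trans[of "a + c" "b + c" "b + d"]) auto
    moreover have "x + y = (a + c) - (b + d)" by (simp add: * algebra_simps)
    ultimately show ?thesis using * closed unfolding P_def by blast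
  qed
  moreover have "0 \<notin> P"
    using irrefl by (auto simp: P_def)
  ultimately have "0 \<notin> convex hull P"
    by (rule zero_notin_convex_hull)
  then obtain bs where bs: "ordered_basis bs" "\<And>c. c \<in> convex hull P \<Longrightarrow> lex_pos bs c"
    using ordered_basis_lex_pos_convex[OF convex_convex_hull] by blast
  have imp: "lex_greater bs a b" if "gr a b" "a \<in> S" "b \<in> S" for a b
    using that bs(2) hull_inc[of _ P] unfolding lex_greater_iff_lex_pos[OF bs(1)] P_def by blast
  have "gr a b \<longleftrightarrow> lex_greater bs a b" if "a \<in> S" "b \<in> S" for a b
  proof
    assume ab: "lex_greater bs a b"
    have "\<not> gr b a"
      using imp[of b a] that ab strict_total_order_on_lex_greater[OF bs(1), of UNIV]
      by (metis UNIV_I irreflp_onD strict_total_order_on_def transp_onD)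
    with total[OF that] ab show "gr a b" by (auto simp: lex_greater_def)
  qed (use imp that in blast)
  with bs(1) that show thesis by (auto simp: induced_on_def)
qed

subsection \<open>Well-ordering\<close>

text \<open>Every sequence has a monotone subsequence, and a decreasing one in the naturals is
  constant once it attains its minimum.\<close>

lemma nat_seq_incseq_subseq:
  fixes s :: "nat \<Rightarrow> nat"
  obtains g where "strict_mono g" "incseq (\<lambda>k. s (g k))"
proof -
  obtain f where f: "strict_mono f" "monoseq (\<lambda>n. s (f n))"
    using seq_monosub[of s] by blast
  show thesis
  proof (cases "incseq (\<lambda>n. s (f n))")
    case True
    with f that show ?thesis by blast
  next
    case False
    with f(2) have dec: "decseq (\<lambda>n. s (f n))" by (simp add: monoseq_iff)
    obtain N where N: "\<And>n. s (f N) \<le> s (f n)"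
      using ex_has_least_nat[of "\<lambda>_. True" 0 "\<lambda>n. s (f n)"] by auto
    have "s (f (k + N)) = s (f N)" for k
      using N[of "k + N"] decseqD[OF dec, of N "k + N"] by simp
    moreover have "strict_mono (\<lambda>k. f (k + N))"
      using f(1) by (simp add: strict_mono_def)
    ultimately show ?thesis using that[of "\<lambda>k. f (k + N)"] by (simp add: incseq_def)
  qed
qed

text \<open>Dickson's lemma for sequences: the coordinates in \<open>F\<close> are treated one at a
  time, and each further refinement preserves the monotonicity already achieved.\<close>

lemma dickson_subseq:
  fixes m :: "nat \<Rightarrow> 'a \<Rightarrow> nat"
  assumes "finite F"
  shows "\<exists>g. strict_mono g \<and> (\<forall>f\<in>F. incseq (\<lambda>k. m (g k) f))"
  using assms
proof induction
  case empty
  show ?case by (intro exI[of _ id]) (simp add: strict_mono_def)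
next
  case (insert a F)
  then obtain g where g: "strict_mono g" "\<forall>f\<in>F. incseq (\<lambda>k. m (g k) f)" by blast
  obtain h where h: "strict_mono h" "incseq (\<lambda>k. m (g (h k)) a)"
    using nat_seq_incseq_subseq[of "\<lambda>k. m (g k) a"] by blast
  have "incseq (\<lambda>k. m (g (h k)) f)" if "f \<in> F" for f
    using g(2) that h(1) by (auto simp: incseq_def strict_mono_less_eq)
  with g(1) h show ?case
    by (intro exI[of _ "g \<circ> h"]) (auto simp: strict_mono_def)
qed

lemma lex_nonneg_sum:
  assumes bs: "ordered_basis bs" and "finite F"
    and "\<And>f. f \<in> F \<Longrightarrow> f = 0 \<or> lex_pos bs f" and "\<And>f. f \<in> F \<Longrightarrow> c f \<ge> 0"
  shows "(\<Sum>f\<in>F. c f *\<^sub>R f) = 0 \<or> lex_pos bs (\<Sum>f\<in>F. c f *\<^sub>R f)"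
  using assms(2-)
proof induction
  case (insert a F)
  have "c a *\<^sub>R a = 0 \<or> lex_pos bs (c a *\<^sub>R a)"
    using insert.prems[of a] lex_pos_scaleR[OF bs] by (auto simp: less_le)
  with insert lex_pos_add[OF bs] show ?case by (auto simp: add_0)
qed simp

text \<open>\<open>S\<close> is only required to lie among the nonnegative integer combinations of
  \<open>F\<close>. This covers both finitely generated semigroups and the nonnegative integral
  points.\<close>

lemma well_ordered_on_lex_greater:
  assumes bs: "ordered_basis bs" and F: "finite F" "\<And>f. f \<in> F \<Longrightarrow> f = 0 \<or> lex_pos bs f"
    and S: "\<And>v. v \<in> S \<Longrightarrow> \<exists>m. v = (\<Sum>f\<in>F. real (m f) *\<^sub>R f)"
  shows "well_ordered_on S (lex_greater bs)"
  unfolding well_ordered_on_def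
proof (intro conjI strict_total_order_on_lex_greater[OF bs] allI impI)
  fix T assume T: "T \<subseteq> S \<and> T \<noteq> {}"
  show "\<exists>m\<in>T. \<forall>t\<in>T. t \<noteq> m \<longrightarrow> lex_greater bs t m"
  proof (rule ccontr)
    assume "\<not> ?thesis"
    \<comment> \<open>By totality, a set without a smallest element has a strictly smaller element
      below each of its members; dependent choice then produces an infinite descent.\<close>
    hence step: "\<exists>y. y \<in> T \<and> lex_pos bs (x - y)" if "x \<in> T" for x
      using that lex_pos_total[OF bs] unfolding lex_greater_iff_lex_pos[OF bs]
      by (metis minus_diff_eq right_minus_eq)
    obtain t where t: "\<And>k. t k \<in> T" "\<And>k. lex_pos bs (t k - t (Suc k))"
      using dependent_nat_choice[of "\<lambda>_ x. x \<in> T" "\<lambda>_ x y. lex_pos bs (x - y)"] T step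
      by (metis ex_in_conv)
    have desc: "lex_pos bs (t i - t j)" if "i < j" for i j
      using that
    proof (induction rule: less_Suc_induct)
      case (2 i j k)
      with lex_pos_add[OF bs, of "t i - t j" "t j - t k"] show ?case by simp
    qed (use t in auto)
    have "\<forall>k. \<exists>m. t k = (\<Sum>f\<in>F. real (m f) *\<^sub>R f)"
      using S t(1) T by blast
    then obtain m where m: "\<And>k. t k = (\<Sum>f\<in>F. real (m k f) *\<^sub>R f)"
      by metis
    obtain g where g: "strict_mono g" "\<forall>f\<in>F. incseq (\<lambda>k. m (g k) f)"
      using dickson_subseq[OF F(1), of m] by blast
    \<comment> \<open>Coefficients grow from \<open>g 0\<close> to \<open>g 1\<close>, so this
      difference is a nonnegative combination of the generators, against the strict descent of
      \<open>t\<close>.\<close>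
    have "t (g 1) - t (g 0) = (\<Sum>f\<in>F. (real (m (g 1) f) - real (m (g 0) f)) *\<^sub>R f)"
      by (simp add: m sum_subtractf scaleR_left_diff_distrib)
    moreover have "real (m (g 1) f) - real (m (g 0) f) \<ge> 0" if "f \<in> F" for f
      using g(2) that by (simp add: incseq_def)
    ultimately have "t (g 1) - t (g 0) = 0 \<or> lex_pos bs (t (g 1) - t (g 0))"
      using lex_nonneg_sum[OF bs F] by simp
    moreover have "lex_pos bs (t (g 0) - t (g 1))"
      using g(1) by (intro desc) (simp add: strict_mono_def)
    ultimately show False
      using lex_pos_add[OF bs, of "t (g 1) - t (g 0)" "t (g 0) - t (g 1)"] lex_pos_zero[of bs] by auto
  qed
qed

text \<open>The positive multiples of \<open>a\<close> have a smallest member, and the next multiple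
  exceeds it by exactly \<open>a\<close>.\<close>

lemma well_ordered_imp_lex_pos:
  assumes bs: "ordered_basis bs" and S: "subsemigroup S"
    and wo: "well_ordered_on S (lex_greater bs)" and a: "a \<in> S" "a \<noteq> 0"
  shows "lex_pos bs a"
proof -
  have mem: "real (Suc k) *\<^sub>R a \<in> S" for k
    using sum_pos_multiples_mem[of S "{a}" "\<lambda>_. Suc k"] S a(1) by (auto simp: subsemigroup_def)
  let ?T = "range (\<lambda>k. real (Suc k) *\<^sub>R a)"
  have "?T \<subseteq> S \<and> ?T \<noteq> {}" using mem by auto
  with wo obtain m where "m \<in> ?T" and m: "\<forall>t\<in>?T. t \<noteq> m \<longrightarrow> lex_greater bs t m"
    unfolding well_ordered_on_def by meson
  then obtain k where k: "m = real (Suc k) *\<^sub>R a" by blast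
  have "real (Suc (Suc k)) *\<^sub>R a - m = a"
    by (simp add: k flip: scaleR_left_diff_distrib)
  moreover from this have "lex_greater bs (real (Suc (Suc k)) *\<^sub>R a) m"
    using m a(2) by (metis rangeI right_minus_eq)
  ultimately show ?thesis by (simp only: lex_greater_iff_lex_pos[OF bs])
qed

text \<open>Collecting equal summands turns the list sums of the definition of finite generation
  into the combinations over a fixed finite set that Dickson's lemma handles.\<close>

lemma sum_list_eq_sum_count:
  fixes xs :: "'a::real_vector list"
  assumes "finite F" "set xs \<subseteq> F"
  shows "sum_list xs = (\<Sum>f\<in>F. real (count_list xs f) *\<^sub>R f)"
  using assms(2)
proof (induction xs)
  case (Cons a xs)
  have "(\<Sum>f\<in>F. real (count_list (a # xs) f) *\<^sub>R f)
      = (\<Sum>f\<in>F. (if f = a then f else 0) + real (count_list xs f) *\<^sub>R f)"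
    by (intro sum.cong) (auto simp: scaleR_left_distrib)
  also have "\<dots> = a + sum_list xs"
    using Cons assms(1) by (simp add: sum.distrib)
  finally show ?case by simp
qed simp

lemma nonneg_integer_point_eq_sum:
  fixes v :: "real ^ 'n"
  assumes "v \<in> nonneg_integer_points"
  shows "\<exists>m. v = (\<Sum>f\<in>Basis. real (m f) *\<^sub>R f)"
proof -
  have "real (nat \<lfloor>v \<bullet> f\<rfloor>) = v \<bullet> f" if "f \<in> Basis" for f
  proof -
    from that obtain i where "f = axis i 1" by (auto simp: Basis_vec_def)
    hence "v \<bullet> f = v $ i" by (simp add: inner_axis)
    with assms show ?thesis
      by (auto simp: nonneg_integer_points_def integer_points_def of_nat_nat)
  qed
  then show ?thesis
    by (intro exI[of _ "\<lambda>f. nat \<lfloor>v \<bullet> f\<rfloor>"]) (simp add: euclidean_representation)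
qed

lemma subsemigroup_integer_points: "subsemigroup integer_points"
  by (auto simp: subsemigroup_def integer_points_def)

lemma subsemigroup_nonneg_integer_points: "subsemigroup nonneg_integer_points"
  by (auto simp: subsemigroup_def nonneg_integer_points_def integer_points_def)

lemma finitely_generated_well_ordered_iff:
  assumes S: "subsemigroup S" "finitely_generated_semigroup S" and bs: "ordered_basis bs"
  shows "well_ordered_on S (lex_greater bs) \<longleftrightarrow> (\<forall>a\<in>S. a \<noteq> 0 \<longrightarrow> lex_pos bs a)"
proof (intro iffI ballI impI)
  fix a assume "well_ordered_on S (lex_greater bs)" "a \<in> S" "a \<noteq> 0"
  thus "lex_pos bs a" by (rule well_ordered_imp_lex_pos[OF bs S(1)])
next
  assume pos: "\<forall>a\<in>S. a \<noteq> 0 \<longrightarrow> lex_pos bs a"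
  obtain F where F: "finite F" "S = {sum_list xs | xs. xs \<noteq> [] \<and> set xs \<subseteq> F}"
    using S(2) by (auto simp: finitely_generated_semigroup_def)
  \<comment> \<open>Generators are one-term sums, so the positivity assumed on \<open>S\<close>
    applies to them.\<close>
  have "f \<in> S" if "f \<in> F" for f
    using that unfolding F(2) by (intro CollectI exI[of _ "[f]"]) simp
  with pos have "f = 0 \<or> lex_pos bs f" if "f \<in> F" for f
    using that by blast
  moreover have "\<exists>m. v = (\<Sum>f\<in>F. real (m f) *\<^sub>R f)" if "v \<in> S" for v
    using that sum_list_eq_sum_count[OF F(1)] unfolding F(2) by blast
  ultimately show "well_ordered_on S (lex_greater bs)"
    by (rule well_ordered_on_lex_greater[OF bs F(1)])
qed

text \<open>The standard basis vectors serve as generators; zero coefficients are allowed, so the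
  origin is among their combinations.\<close>

lemma nonneg_integer_points_well_ordered_iff:
  assumes bs: "ordered_basis bs"
  shows "well_ordered_on (nonneg_integer_points :: (real ^ 'n) set) (lex_greater bs)
    \<longleftrightarrow> (\<forall>a\<in>nonneg_integer_points. a \<noteq> 0 \<longrightarrow> lex_pos bs a)"
proof (intro iffI ballI impI)
  fix a :: "real ^ 'n"
  assume "well_ordered_on (nonneg_integer_points :: (real ^ 'n) set) (lex_greater bs)"
    "a \<in> nonneg_integer_points" "a \<noteq> 0"
  thus "lex_pos bs a"
    by (rule well_ordered_imp_lex_pos[OF bs subsemigroup_nonneg_integer_points])
next
  assume pos: "\<forall>a\<in>nonneg_integer_points. a \<noteq> 0 \<longrightarrow> lex_pos bs a"
  have "f = 0 \<or> lex_pos bs f" if "f \<in> Basis" for f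
  proof -
    have "f \<in> nonneg_integer_points"
      using that by (auto simp: Basis_vec_def nonneg_integer_points_def integer_points_def axis_def)
    with pos show ?thesis by blast
  qed
  thus "well_ordered_on (nonneg_integer_points :: (real ^ 'n) set) (lex_greater bs)"
    using nonneg_integer_point_eq_sum by (intro well_ordered_on_lex_greater[OF bs finite_Basis])
qed

theorem theorem31:
  shows
    "((\<forall>gr. strict_total_order_on (integer_points :: (real ^ 'n) set) gr
            \<and> compatible_with_add_on integer_points gr
          \<longrightarrow> (\<exists>x. ordered_basis x \<and> induced_on integer_points gr (lex_greater x)))
      \<and> (\<forall>S gr. S \<subseteq> (integer_points :: (real ^ 'n) set) \<and> subsemigroup S
            \<and> strict_total_order_on S gr \<and> compatible_with_add_on S gr
          \<longrightarrow> (\<exists>x. ordered_basis x \<and> induced_on S gr (lex_greater x))))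
     \<and> (\<forall>S x. S \<subseteq> (integer_points :: (real ^ 'n) set) \<and> subsemigroup S
            \<and> finitely_generated_semigroup S \<and> ordered_basis x
          \<longrightarrow> (well_ordered_on S (lex_greater x)
               \<longleftrightarrow> (\<forall>a\<in>S. a \<noteq> 0 \<longrightarrow> lex_greater x (2 *\<^sub>R a) a)))
     \<and> (\<forall>x. ordered_basis x
          \<longrightarrow> (well_ordered_on (nonneg_integer_points :: (real ^ 'n) set) (lex_greater x)
               \<longleftrightarrow> (\<forall>a\<in>nonneg_integer_points. a \<noteq> 0 \<longrightarrow> lex_greater x a 0)))"
proof -
  have "\<exists>x. ordered_basis x \<and> induced_on S gr (lex_greater x)"
    if "S \<subseteq> (integer_points :: (real ^ 'n) set) \<and> subsemigroup S
      \<and> strict_total_order_on S gr \<and> compatible_with_add_on S gr" for S gr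
    using that by (meson compatible_order_induced_by_lex)
  \<comment> \<open>Both criteria of the theorem say the same about \<open>a\<close>, because
    \<open>2 *\<^sub>R a - a\<close> and \<open>a - 0\<close> are both \<open>a\<close>.\<close>
  moreover have "lex_greater x (2 *\<^sub>R a) a \<longleftrightarrow> lex_pos x a" "lex_greater x a 0 \<longleftrightarrow> lex_pos x a"
    if "ordered_basis x" for x and a :: "real ^ 'n"
    using that by (simp_all add: lex_greater_iff_lex_pos scaleR_2)
  ultimately show ?thesis
    by (simp add: subsemigroup_integer_points finitely_generated_well_ordered_iff
        nonneg_integer_points_well_ordered_iff)
qed

end
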